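(* Let $R>1$ and let $f:D_R\to\mathbb{C}$ be analytic in $D_R$, $f(z)=\sum_{p=0}^\infty c_p z^p$. If $f$ is not a polynomial of degree $\le 1$, then for every $1\le r<R$ we have $\|G_n^\alpha(f)-f\|_r\sim\frac1n$, $n\in\mathbb{N}$, for $\alpha\in[0,1]$, with constants in the equivalence depending only on $f$ and $r$; that is, there exist constants $0<C_1\le C_2<\infty$ depending only on $f$ and $r$ such that for all $\alpha\in[0,1]$ and all $n\in\mathbb{N}$, $$\frac{C_1}{n}\le\|G_n^\alpha(f)-f\|_r\le\frac{C_2}{n}.$$
   Context: $\mathbb{N}=\{1,2,3,\dots\}$; $D_R=\{z\in\mathbb{C}:|z|<R\}$, $\overline{D}_r=\{z\in\mathbb{C}:|z|\le r\}$, and $\|g\|_r=\max_{z\in\overline{D}_r}|g(z)|$. $G_n^\alpha(f)$ denotes the function $z\mapsto G_n^\alpha(f;z)$. For $0\le k\le n$ let $p_{n,k}(t)=\binom{n}{k}t^k(1-t)^{n-k}$. For $\alpha\in[0,1]$ the $\alpha$-Bernstein polynomials are $q_{1,0}^\alpha(z)=1-z$, $q_{1,1}^\alpha(z)=z$ and, for $n\ge2$, $0\le k\le n$, $$q_{n,k}^\alpha(z)=\left[\binom{n-2}{k}(1-\alpha)z+\binom{n-2}{k-2}(1-\alpha)(1-z)+\binom{n}{k}\alpha z(1-z)\right]z^{k-1}(1-z)^{n-k-1},$$ where $\binom{m}{j}=0$ if $j<0$ or $j>m$, and the expression is understood as a polynomial in $z$ after cancellation (e.g. $q_{n,0}^\alpha(z)=(1-\alpha)(1-z)^{n-1}+\alpha(1-z)^n$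 and $q_{n,n}^\alpha(z)=(1-\alpha)z^{n-1}+\alpha z^n$). For $n\in\mathbb{N}$, $\alpha\in[0,1]$, $z\in\mathbb{C}$ and $f$ a complex-valued analytic function in $D_R$ with $R>1$, the complex genuine $\alpha$-Bernstein-Durrmeyer operator is $$G_n^\alpha(f;z)=q_{n,0}^\alpha(z)f(0)+q_{n,n}^\alpha(z)f(1)+(n-1)\sum_{k=1}^{n-1}q_{n,k}^\alpha(z)\int_0^1 p_{n-2,k-1}(t)f(t)\,dt$$ (the sum is empty for $n=1$). *)

theory Defs
  imports "HOL-Complex_Analysis.Complex_Analysis"
begin

definition bernstein_basis :: "nat \<Rightarrow> nat \<Rightarrow> real \<Rightarrow> real" where
  "bernstein_basis n k t = real (n choose k) * t ^ k * (1 - t) ^ (n - k)"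

(* For n >= 2 the common factor z^(k-1) (1-z)^(n-k-1) is multiplied into the bracket, so that
   the formula is a polynomial at z = 0 and z = 1 as well.  The conditional encodes
   binom (n-2) (k-2) = 0 for k < 2, which truncated subtraction would miss.  Where a truncated
   exponent differs from the intended one, the binomial coefficient in front of it is 0. *)
definition alpha_bernstein :: "nat \<Rightarrow> real \<Rightarrow> nat \<Rightarrow> complex \<Rightarrow> complex" where
  "alpha_bernstein n \<alpha> k z =
     (if n = 1 then (if k = 0 then 1 - z else if k = 1 then z else 0)
      else of_nat ((n - 2) choose k) * (1 - of_real \<alpha>) * z ^ k * (1 - z) ^ (n - k - 1)
         + (if k < 2 then 0
            else of_nat ((n - 2) choose (k - 2)) * (1 - of_real \<alpha>) * z ^ (k - 1) * (1 - z) ^ (n - k))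
         + of_nat (n choose k) * of_real \<alpha> * z ^ k * (1 - z) ^ (n - k))"

lemma alpha_bernstein_factored:
  assumes "n \<ge> 2" "k \<le> n" "z \<noteq> 0" "z \<noteq> 1"
  shows "alpha_bernstein n \<alpha> k z =
    (of_nat ((n - 2) choose k) * (1 - of_real \<alpha>) * z
     + (if k < 2 then 0 else of_nat ((n - 2) choose (k - 2))) * (1 - of_real \<alpha>) * (1 - z)
     + of_nat (n choose k) * of_real \<alpha> * z * (1 - z))
    * z powi (int k - 1) * (1 - z) powi (int n - int k - 1)"
proof -
  have nz: "1 - z \<noteq> 0" using assms by simp
  have zk: "z * z powi (int k - 1) = z ^ k"
    using assms(3) by (simp add: power_int_diff)
  have wk: "(1 - z) * (1 - z) powi (int n - int k - 1) = (1 - z) ^ (n - k)"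
    using nz assms(2) by (simp add: power_int_diff flip: of_nat_diff)
  have A: "of_nat ((n - 2) choose k) * (1 - z) powi (int n - int k - 1)
         = of_nat ((n - 2) choose k) * (1 - z) ^ (n - k - 1)"
  proof (cases "k \<le> n - 2")
    case True
    then have "int n - int k - 1 = int (n - k - 1)" using assms(1) by linarith
    then show ?thesis by (metis power_int_of_nat)
  qed (simp add: binomial_eq_0)
  have B: "z powi (int k - 1) = z ^ (k - 1)" if "\<not> k < 2"
  proof -
    have "int k - 1 = int (k - 1)" using that by linarith
    then show ?thesis by (metis power_int_of_nat)
  qed
  have "(of_nat ((n - 2) choose k) * (1 - of_real \<alpha>) * z
     + (if k < 2 then 0 else of_nat ((n - 2) choose (k - 2))) * (1 - of_real \<alpha>) * (1 - z)
     + of_nat (n choose k) * of_real \<alpha> * z * (1 - z))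
    * z powi (int k - 1) * (1 - z) powi (int n - int k - 1)
    = (1 - of_real \<alpha>) * (z * z powi (int k - 1))
        * (of_nat ((n - 2) choose k) * (1 - z) powi (int n - int k - 1))
    + (if k < 2 then 0 else of_nat ((n - 2) choose (k - 2))) * (1 - of_real \<alpha>)
        * z powi (int k - 1) * ((1 - z) * (1 - z) powi (int n - int k - 1))
    + of_nat (n choose k) * of_real \<alpha> * (z * z powi (int k - 1))
        * ((1 - z) * (1 - z) powi (int n - int k - 1))"
    by (simp add: algebra_simps)
  also have "\<dots> = alpha_bernstein n \<alpha> k z"
    using assms(1) unfolding zk wk A by (simp add: alpha_bernstein_def B)
  finally show ?thesis by simp
qed

definition genuine_alpha_BD :: "nat \<Rightarrow> real \<Rightarrow> (complex \<Rightarrow> complex) \<Rightarrow> complex \<Rightarrow> complex" where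
  "genuine_alpha_BD n \<alpha> f z =
     alpha_bernstein n \<alpha> 0 z * f 0 + alpha_bernstein n \<alpha> n z * f 1
     + of_nat (n - 1) * (\<Sum>k = 1..n - 1. alpha_bernstein n \<alpha> k z *
         integral {0..1} (\<lambda>t::real. of_real (bernstein_basis (n - 2) (k - 1) t) * f (of_real t)))"

definition disc_norm :: "real \<Rightarrow> (complex \<Rightarrow> complex) \<Rightarrow> real" where
  "disc_norm r g = (SUP z\<in>cball 0 r. norm (g z))"

lemma disc_norm_is_max:
  assumes "0 \<le> r" "continuous_on (cball 0 r) g"
  shows "\<exists>z\<in>cball 0 r. disc_norm r g = norm (g z) \<and> (\<forall>w\<in>cball 0 r. norm (g w) \<le> norm (g z))"
proof -
  have "\<exists>z\<in>cball 0 r. \<forall>w\<in>cball 0 r. norm (g w) \<le> norm (g z)"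
    using assms by (intro continuous_attains_sup continuous_on_norm) auto
  then obtain z where z: "z \<in> cball 0 r" "\<forall>w\<in>cball 0 r. norm (g w) \<le> norm (g z)" by blast
  have "disc_norm r g = norm (g z)"
    unfolding disc_norm_def by (rule cSup_eq_maximum) (use z in auto)
  with z show ?thesis by blast
qed

end

theory Submission imports Defs begin

text \<open>Write \<open>U\<^sub>n\<close> for the classical operator (\<open>\<alpha> = 1\<close>). On monomials \<open>G\<close> of order \<open>n\<close> is
  \<open>\<alpha> U\<^sub>n + (1 - \<alpha>) U\<^bsub>n-1\<^esub>\<close>, so that everything about \<open>\<alpha>\<close> reduces to convexity. By
  Vandermonde's identity \<open>U\<^sub>n z^p\<close> is \<open>\<Sum>\<^sub>j w\<^sub>j z^j\<close> with \<open>w\<close> a probability distribution on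
  \<open>{0..p}\<close> of mean \<open>p - p (p - 1) / (n + p - 1)\<close>; hence \<open>U\<^sub>n z^p\<close> differs from \<open>z^p\<close> by at most
  \<open>2 p^2 r^p / n\<close> on the disc of radius \<open>r\<close>, and summing over the Taylor series of \<open>f\<close> gives the
  upper bound.

  No asymptotic formula is needed for the lower bound: on \<open>[0, 1]\<close> the operator is positive, fixes
  affine functions and lowers \<open>z (1 - z)\<close> by the factor \<open>1 - \<kappa>\<close> with \<open>\<kappa> \<ge> 1 / n\<close>. If \<open>f\<close> is not
  affine, comparing it with a small multiple of \<open>z (1 - z)\<close> at a maximum point yields the bound for
  all \<open>n\<close> and \<open>\<alpha>\<close> at once.\<close>

section \<open>Beta integrals and the node functionals\<close>

text \<open>Integration by parts: \<open>t ^ Suc a * (1 - t) ^ Suc b\<close> vanishes at both ends,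
  so its derivative integrates to 0, and the pair \<open>(a, Suc b)\<close> reduces to
  \<open>(Suc a, b)\<close> with factor \<open>Suc b / Suc a\<close>.\<close>

lemma has_integral_Beta_nat:
  "((\<lambda>t::real. t ^ a * (1 - t) ^ b) has_integral fact a * fact b / fact (a + b + 1)) {0..1}"
proof (induction b arbitrary: a)
  case 0
  have "((\<lambda>t::real. t ^ a) has_integral (1 ^ Suc a / real (Suc a) - 0 ^ Suc a / real (Suc a))) {0..1}"
    by (intro fundamental_theorem_of_calculus)
       (auto intro!: derivative_eq_intros simp flip: has_real_derivative_iff_has_vector_derivative
             simp del: power_Suc of_nat_Suc)
  then show ?case by simp
next
  case (Suc b)
  have "((\<lambda>t::real. real (Suc a) * (t ^ a * (1 - t) ^ Suc b) - real (Suc b) * (t ^ Suc a * (1 - t) ^ b))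
          has_integral (1 ^ Suc a * (1 - 1) ^ Suc b - 0 ^ Suc a * (1 - 0) ^ Suc b)) {0..1}"
    by (intro fundamental_theorem_of_calculus)
       (auto intro!: derivative_eq_intros simp flip: has_real_derivative_iff_has_vector_derivative
             simp: algebra_simps simp del: power_Suc of_nat_Suc)
  from has_integral_add[OF this has_integral_mult_right[OF Suc.IH[of "Suc a"], of "real (Suc b)"]]
  have "((\<lambda>t::real. real (Suc a) * (t ^ a * (1 - t) ^ Suc b)) has_integral
          real (Suc b) * (fact (Suc a) * fact b / fact (Suc a + b + 1))) {0..1}"
    by simp
  from has_integral_mult_right[OF this, of "1 / real (Suc a)"]
  show ?case
    by (simp add: field_simps del: of_nat_Suc power_Suc)
qed

text \<open>The functional multiplying \<open>alpha_bernstein n \<alpha> k\<close> in the operator.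
  It does not involve \<alpha>; treating endpoint evaluations and integrals alike makes the operator
  a single sum over \<open>{..n}\<close>.\<close>

definition node_value :: "nat \<Rightarrow> (complex \<Rightarrow> complex) \<Rightarrow> nat \<Rightarrow> complex" where
  "node_value n f k =
     (if k = 0 then f 0 else if k = n then f 1
      else of_nat (n - 1) *
        integral {0..1} (\<lambda>t::real. of_real (bernstein_basis (n - 2) (k - 1) t) * f (of_real t)))"

lemma genuine_alpha_BD_eq_sum:
  assumes "n \<ge> 1"
  shows "genuine_alpha_BD n \<alpha> f z = (\<Sum>k\<le>n. alpha_bernstein n \<alpha> k z * node_value n f k)"
proof -
  have "{..n} = insert 0 (insert n {1..n - 1})" using assms by auto
  then have "(\<Sum>k\<le>n. alpha_bernstein n \<alpha> k z * node_value n f k) =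
     alpha_bernstein n \<alpha> 0 z * f 0 + (alpha_bernstein n \<alpha> n z * f 1
      + (\<Sum>k = 1..n - 1. alpha_bernstein n \<alpha> k z * node_value n f k))"
    using assms by (simp add: node_value_def)
  also have "(\<Sum>k = 1..n - 1. alpha_bernstein n \<alpha> k z * node_value n f k) =
      of_nat (n - 1) * (\<Sum>k = 1..n - 1. alpha_bernstein n \<alpha> k z *
         integral {0..1} (\<lambda>t::real. of_real (bernstein_basis (n - 2) (k - 1) t) * f (of_real t)))"
    unfolding sum_distrib_left by (intro sum.cong) (auto simp: node_value_def)
  finally show ?thesis by (simp add: genuine_alpha_BD_def)
qed

lemma node_value_one:
  assumes "k \<le> n"
  shows "node_value n (\<lambda>z. 1) k = 1"
proof (cases "k = 0 \<or> k = n")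
  case False
  \<comment> \<open>At an interior node \<open>n - 2 = i + b\<close>, so the basis polynomial has
    exponents \<open>i\<close> and \<open>b\<close> and no truncated subtraction remains.\<close>
  define i b where "i = k - 1" and "b = n - k - 1"
  have n: "n = i + b + 2" "k = Suc i" using False assms by (auto simp: i_def b_def)
  from has_integral_mult_right[OF has_integral_Beta_nat[of i b], of "real ((i + b) choose i)"]
  have "(bernstein_basis (i + b) i has_integral
      real ((i + b) choose i) * (fact i * fact b / fact (i + b + 1))) {0..1}"
    by (simp add: bernstein_basis_def[abs_def] mult.assoc)
  also have "real ((i + b) choose i) * (fact i * fact b / fact (i + b + 1)) = 1 / real (i + b + 1)"
    by (simp add: binomial_fact del: of_nat_Suc of_nat_add)
  finally have "((\<lambda>t. complex_of_real (bernstein_basis (i + b) i t)) has_integral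
      of_real (1 / real (i + b + 1))) {0..1}"
    by (rule has_integral_of_real)
  then show ?thesis
    using n by (simp add: node_value_def integral_unique del: of_nat_Suc of_nat_add)
qed (auto simp: node_value_def)

text \<open>A quotient of Beta integrals, that is \<open>k (k+1) ... (k+q)\<close> over
  \<open>n (n+1) ... (n+q)\<close>, written with binomials to suit Vandermonde's identity. At
  \<open>k = 0\<close> and \<open>k = n\<close> it agrees with endpoint evaluation.\<close>

lemma node_value_power:
  assumes "k \<le> n"
  shows "node_value n (\<lambda>z. z ^ Suc q) k
       = of_nat ((k + q) choose Suc q) / of_nat ((n + q) choose Suc q)"
proof (cases "k = 0 \<or> k = n")
  case False
  define i b where "i = k - 1" and "b = n - k - 1"
  have n: "n = i + b + 2" "k = Suc i" using False assms by (auto simp: i_def b_def)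
  from has_integral_mult_right[OF has_integral_Beta_nat[of "i + Suc q" b], of "real ((i + b) choose i)"]
  have "((\<lambda>t. bernstein_basis (i + b) i t * t ^ Suc q) has_integral
      real ((i + b) choose i) * (fact (i + Suc q) * fact b / fact (i + Suc q + b + 1))) {0..1}"
    by (simp add: bernstein_basis_def[abs_def] power_add mult_ac)
  also have "real ((i + b) choose i) * (fact (i + Suc q) * fact b / fact (i + Suc q + b + 1)) =
      (real ((k + q) choose Suc q) / real ((n + q) choose Suc q)) / real (i + b + 1)"
  proof -
    have "real ((k + q) choose Suc q) = fact (i + Suc q) / (fact (Suc q) * fact i)"
      using n by (subst binomial_fact) auto
    moreover have "real ((n + q) choose Suc q) = fact (i + Suc q + b + 1) / (fact (Suc q) * fact (i + b + 1))"
      using n by (subst binomial_fact) (auto simp: algebra_simps simp del: fact_Suc)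
    moreover have "(fact (i + b + 1) :: real) = real (i + b + 1) * fact (i + b)"
      by simp
    moreover have "real ((i + b) choose i) = fact (i + b) / (fact i * fact b)"
      by (simp add: binomial_fact)
    \<comment> \<open>Free variables replace the factorials, so that only a cancellation of
      fractions is left.\<close>
    moreover have "x / (u * v) * (w * v / y) = (w / (s * u)) / (y / (s * (l * x))) / l"
      if "x \<noteq> 0" "v \<noteq> 0" "s \<noteq> 0" "l \<noteq> 0" for x u v w y s l :: real
      using that by simp
    ultimately show ?thesis
      by (simp only: fact_nonzero of_nat_eq_0_iff add_is_0 one_neq_zero simp_thms)
  qed
  finally have "((\<lambda>t. complex_of_real (bernstein_basis (i + b) i t * t ^ Suc q)) has_integral
      of_real ((real ((k + q) choose Suc q) / real ((n + q) choose Suc q)) / real (i + b + 1))) {0..1}"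
    by (rule has_integral_of_real)
  then show ?thesis
    using n by (simp add: node_value_def integral_unique del: of_nat_Suc of_nat_add power_Suc)
qed (use assms in \<open>auto simp: node_value_def\<close>)

section \<open>Bernstein sums and the splitting of the operator in \<alpha>\<close>

text \<open>The Bernstein polynomial of a coefficient sequence instead of samples
  \<open>f (k / n)\<close>, since node values are mostly integrals.\<close>

definition bernstein_sum :: "nat \<Rightarrow> (nat \<Rightarrow> complex) \<Rightarrow> complex \<Rightarrow> complex" where
  "bernstein_sum n g z = (\<Sum>k\<le>n. of_nat (n choose k) * z ^ k * (1 - z) ^ (n - k) * g k)"

lemma bernstein_sum_const [simp]: "bernstein_sum n (\<lambda>k. a) z = a"
  using binomial_ring[of z "1 - z" n] by (simp add: bernstein_sum_def flip: sum_distrib_right)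

text \<open>Factorial moments of the binomial distribution: \<open>choose_mult\<close> pulls out
  \<open>n choose j\<close>, and the rest is the total mass of the basis of order
  \<open>n - j\<close>.\<close>

lemma bernstein_sum_binomial:
  "bernstein_sum n (\<lambda>k. of_nat (k choose j)) z = of_nat (n choose j) * z ^ j"
proof (cases "j \<le> n")
  case True
  have "bernstein_sum n (\<lambda>k. of_nat (k choose j)) z
      = (\<Sum>k\<in>{j..n}. of_nat (n choose k) * z ^ k * (1 - z) ^ (n - k) * of_nat (k choose j))"
    unfolding bernstein_sum_def by (intro sum.mono_neutral_right) auto
  also have "\<dots> = (\<Sum>i\<le>n - j. of_nat (n choose (j + i)) * z ^ (j + i) * (1 - z) ^ (n - (j + i))
      * of_nat ((j + i) choose j))"
    by (rule sum.reindex_bij_witness[of _ "\<lambda>i. j + i" "\<lambda>k. k - j"]) (use True in auto)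
  also have "\<dots> = (\<Sum>i\<le>n - j. of_nat (n choose j) * z ^ j
      * (of_nat ((n - j) choose i) * z ^ i * (1 - z) ^ (n - j - i)))"
  proof (intro sum.cong refl)
    fix i assume "i \<in> {..n - j}"
    then have "(n choose (j + i)) * ((j + i) choose j) = (n choose j) * ((n - j) choose i)"
      using choose_mult[of j "j + i" n] True by simp
    then have "(of_nat (n choose (j + i)) :: complex) * of_nat ((j + i) choose j)
        = of_nat (n choose j) * of_nat ((n - j) choose i)"
      by (metis of_nat_mult)
    then show "of_nat (n choose (j + i)) * z ^ (j + i) * (1 - z) ^ (n - (j + i)) * of_nat ((j + i) choose j)
       = of_nat (n choose j) * z ^ j * (of_nat ((n - j) choose i) * z ^ i * (1 - z) ^ (n - j - i))"
      by (simp add: power_add mult_ac)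
  qed
  also have "\<dots> = of_nat (n choose j) * z ^ j"
    using bernstein_sum_const[of "n - j" 1 z, unfolded bernstein_sum_def]
    by (simp del: diff_diff_left flip: sum_distrib_left)
  finally show ?thesis .
qed (auto simp: bernstein_sum_def binomial_eq_0 intro!: sum.neutral)

text \<open>Absorption turns \<open>(m - 1) choose k\<close> and
  \<open>(m - 1) choose (k - 1)\<close> into \<open>m choose k\<close> times
  \<open>(m - k) / m\<close> and \<open>k / m\<close>, so both \<alpha>-free terms become Bernstein
  sums of order \<open>m\<close>.\<close>

lemma alpha_bernstein_sum:
  assumes "m \<ge> 1"
  shows "(\<Sum>k\<le>Suc m. alpha_bernstein (Suc m) \<alpha> k z * g k) =
    of_real \<alpha> * bernstein_sum (Suc m) g z + (1 - of_real \<alpha>) *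
      bernstein_sum m (\<lambda>i. (of_nat (m - i) * g i + of_nat i * g (Suc i)) / of_nat m) z"
proof -
  have m: "(of_nat m :: complex) \<noteq> 0" using assms by auto
  have A: "(\<Sum>k\<le>Suc m. of_nat ((m - 1) choose k) * z ^ k * (1 - z) ^ (m - k) * g k)
     = (\<Sum>k\<le>m. of_nat (m choose k) * z ^ k * (1 - z) ^ (m - k) * (of_nat (m - k) * g k / of_nat m))"
  proof -
    have *: "(of_nat ((m - 1) choose k) :: complex)
        = of_nat (m choose k) * of_nat (m - k) / of_nat m" if "k \<le> m" for k
    proof -
      have "(m - k) * (m choose k) = m * ((m - 1) choose k)"
        using binomial_absorb_comp[of m k] by simp
      then have "of_nat (m - k) * of_nat (m choose k) = (of_nat m * of_nat ((m - 1) choose k) :: complex)"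
        by (metis of_nat_mult)
      then show ?thesis using m by (simp add: field_simps)
    qed
    have "(\<Sum>k\<le>Suc m. of_nat ((m - 1) choose k) * z ^ k * (1 - z) ^ (m - k) * g k)
       = (\<Sum>k\<le>m. of_nat ((m - 1) choose k) * z ^ k * (1 - z) ^ (m - k) * g k)"
      using assms by (simp add: binomial_eq_0)
    also have "\<dots> = (\<Sum>k\<le>m. of_nat (m choose k) * z ^ k * (1 - z) ^ (m - k)
        * (of_nat (m - k) * g k / of_nat m))"
      by (intro sum.cong refl, subst *) simp_all
    finally show ?thesis .
  qed
  \<comment> \<open>The index is shifted by one; the vanishing term \<open>k = 1\<close> matches the
    factor \<open>of_nat 0\<close> on the right.\<close>
  have B: "(\<Sum>k\<le>Suc m. (if k < 2 then 0 else
        of_nat ((m - 1) choose (k - 2)) * z ^ (k - 1) * (1 - z) ^ (Suc m - k)) * g k)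
     = (\<Sum>k\<le>m. of_nat (m choose k) * z ^ k * (1 - z) ^ (m - k) * (of_nat k * g (Suc k) / of_nat m))"
  proof -
    have *: "(of_nat ((m - 1) choose (k - 1)) :: complex)
        = of_nat (m choose k) * of_nat k / of_nat m" if "k > 0" for k
    proof -
      have "of_nat k * of_nat (m choose k) = (of_nat m * of_nat ((m - 1) choose (k - 1)) :: complex)"
        using times_binomial_minus1_eq[OF that, of m] by (metis of_nat_mult)
      then show ?thesis using m by (simp add: field_simps)
    qed
    show ?thesis
      unfolding sum.atMost_Suc_shift by (auto intro!: sum.cong simp: *[unfolded One_nat_def] numeral_2_eq_2)
  qed
  have "(\<Sum>k\<le>Suc m. alpha_bernstein (Suc m) \<alpha> k z * g k) =
     of_real \<alpha> * bernstein_sum (Suc m) g z + (1 - of_real \<alpha>) *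
     ((\<Sum>k\<le>Suc m. of_nat ((m - 1) choose k) * z ^ k * (1 - z) ^ (m - k) * g k)
     + (\<Sum>k\<le>Suc m. (if k < 2 then 0 else
        of_nat ((m - 1) choose (k - 2)) * z ^ (k - 1) * (1 - z) ^ (Suc m - k)) * g k))"
    unfolding bernstein_sum_def sum_distrib_left sum.distrib[symmetric]
    using assms by (intro sum.cong) (auto simp: alpha_bernstein_def algebra_simps)
  also have "\<dots> = of_real \<alpha> * bernstein_sum (Suc m) g z + (1 - of_real \<alpha>) *
      bernstein_sum m (\<lambda>i. (of_nat (m - i) * g i + of_nat i * g (Suc i)) / of_nat m) z"
    unfolding A B bernstein_sum_def by (simp add: sum.distrib add_divide_distrib distrib_left)
  finally show ?thesis .
qed

section \<open>The operator on monomials\<close>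

text \<open>Expands the node values of a monomial in the \<open>k choose j\<close>, whose Bernstein
  sums are known.\<close>

lemma binomial_shift_convolution:
  "(k + q) choose Suc q = (\<Sum>j\<le>Suc q. (k choose j) * (q choose (Suc q - j)))"
  by (rule vandermonde[symmetric])

text \<open>The hypergeometric distribution: the chance that \<open>Suc q\<close> draws from
  \<open>n + q\<close> objects contain \<open>j\<close> of \<open>n\<close> marked ones.\<close>

definition durrmeyer_weight :: "nat \<Rightarrow> nat \<Rightarrow> nat \<Rightarrow> real" where
  "durrmeyer_weight n q j = real ((n choose j) * (q choose (Suc q - j))) / real ((n + q) choose Suc q)"

lemma bernstein_sum_node_value_power:
  "bernstein_sum n (node_value n (\<lambda>z. z ^ Suc q)) z
     = (\<Sum>j\<le>Suc q. of_real (durrmeyer_weight n q j) * z ^ j)"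
proof -
  have "bernstein_sum n (node_value n (\<lambda>z. z ^ Suc q)) z
    = bernstein_sum n (\<lambda>k. of_nat ((k + q) choose Suc q) / of_nat ((n + q) choose Suc q)) z"
    unfolding bernstein_sum_def by (intro sum.cong) (simp_all add: node_value_power del: power_Suc)
  also have "\<dots> = (\<Sum>j\<le>Suc q. of_nat (q choose (Suc q - j)) * bernstein_sum n (\<lambda>k. of_nat (k choose j)) z)
      / of_nat ((n + q) choose Suc q)"
    unfolding bernstein_sum_def binomial_shift_convolution of_nat_sum of_nat_mult
      sum_distrib_left sum_divide_distrib
    by (subst sum.swap) (simp add: mult_ac)
  also have "\<dots> = (\<Sum>j\<le>Suc q. of_real (durrmeyer_weight n q j) * z ^ j)"
    unfolding bernstein_sum_binomial durrmeyer_weight_def sum_divide_distrib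
    by (intro sum.cong) (simp_all add: mult_ac)
  finally show ?thesis .
qed

text \<open>The \<open>(1 - \<alpha>)\<close>-part of \<open>alpha_bernstein_sum\<close> uses averages of neighbouring node values; for a
  monomial these are again node values, of order one less.\<close>

lemma node_value_power_elevate:
  assumes "m \<ge> 1" "i \<le> m"
  shows "(of_nat (m - i) * node_value (Suc m) (\<lambda>z. z ^ Suc q) i
          + of_nat i * node_value (Suc m) (\<lambda>z. z ^ Suc q) (Suc i)) / of_nat m
       = node_value m (\<lambda>z. z ^ Suc q) i"
proof -
  have 1: "i * ((i + q) choose q) = Suc q * ((i + q) choose Suc q)"
    using binomial_absorb_comp[of "i + q" q] Suc_times_binomial[of q "i + q - 1"]
    by (cases i) (simp_all add: algebra_simps)
  have 2: "m * ((Suc m + q) choose Suc q) = (m + Suc q) * ((m + q) choose Suc q)"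
    using binomial_absorb_comp[of "Suc m + q" "Suc q"] by simp
  \<comment> \<open>Pascal's rule gives
    \<open>m * ((i + q) choose Suc q) + i * ((i + q) choose q)\<close>, and 1 rewrites the second
    term. The resulting factor \<open>m + Suc q\<close> cancels against the one in 2.\<close>
  have "(m - i) * ((i + q) choose Suc q) + i * ((Suc i + q) choose Suc q)
      = (m + Suc q) * ((i + q) choose Suc q)"
  proof -
    obtain d where "m = i + d" using assms(2) le_Suc_ex by blast
    then show ?thesis using 1 by (simp add: algebra_simps)
  qed
  then have 3: "(of_nat (m - i) * of_nat ((i + q) choose Suc q) + of_nat i * of_nat ((Suc i + q) choose Suc q)
      :: complex) = of_nat (m + Suc q) * of_nat ((i + q) choose Suc q)"
    by (metis of_nat_add of_nat_mult)
  have 4: "of_nat m * of_nat ((Suc m + q) choose Suc q) =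
      (of_nat (m + Suc q) * of_nat ((m + q) choose Suc q) :: complex)"
    using 2 by (metis of_nat_mult)
  have nz: "of_nat ((m + q) choose Suc q) \<noteq> (0::complex)" "of_nat ((Suc m + q) choose Suc q) \<noteq> (0::complex)"
     "of_nat m \<noteq> (0::complex)" "of_nat (m + Suc q) \<noteq> (0::complex)"
    using assms(1) by (auto simp del: of_nat_Suc of_nat_add)
  have "(of_nat (m - i) * node_value (Suc m) (\<lambda>z. z ^ Suc q) i
          + of_nat i * node_value (Suc m) (\<lambda>z. z ^ Suc q) (Suc i)) / of_nat m
     = (of_nat (m - i) * of_nat ((i + q) choose Suc q) + of_nat i * of_nat ((Suc i + q) choose Suc q))
       / (of_nat m * of_nat ((Suc m + q) choose Suc q))"
    using assms by (simp add: node_value_power add_divide_distrib mult_ac del: power_Suc binomial_Suc_Suc add_Suc)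
  also have "\<dots> = of_nat ((i + q) choose Suc q) / of_nat ((m + q) choose Suc q)"
    unfolding 3 4 using nz by simp
  also have "\<dots> = node_value m (\<lambda>z. z ^ Suc q) i"
    using assms(2) by (simp only: node_value_power)
  finally show ?thesis .
qed

lemma genuine_alpha_BD_1:
  "genuine_alpha_BD 1 \<alpha> f z = bernstein_sum 1 (node_value 1 f) z"
  by (simp add: genuine_alpha_BD_eq_sum bernstein_sum_def alpha_bernstein_def)

text \<open>For \<open>n = 1\<close> the operator is linear interpolation for every \<open>\<alpha>\<close>, which is what \<open>max\<close> encodes.\<close>

lemma genuine_alpha_BD_power:
  assumes "n \<ge> 1"
  shows "genuine_alpha_BD n \<alpha> (\<lambda>z. z ^ Suc q) z =
    of_real \<alpha> * (\<Sum>j\<le>Suc q. of_real (durrmeyer_weight n q j) * z ^ j)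
    + (1 - of_real \<alpha>) * (\<Sum>j\<le>Suc q. of_real (durrmeyer_weight (max 1 (n - 1)) q j) * z ^ j)"
proof (cases "n = 1")
  case True
  then show ?thesis
    by (simp only: genuine_alpha_BD_1 bernstein_sum_node_value_power)
       (simp add: algebra_simps del: power_Suc)
next
  case False
  define m where "m = n - 1"
  have m: "m \<ge> 1" "n = Suc m" "max 1 (n - 1) = m" using False assms by (auto simp: m_def)
  have "bernstein_sum m (\<lambda>i. (of_nat (m - i) * node_value (Suc m) (\<lambda>z. z ^ Suc q) i
          + of_nat i * node_value (Suc m) (\<lambda>z. z ^ Suc q) (Suc i)) / of_nat m) z
       = bernstein_sum m (node_value m (\<lambda>z. z ^ Suc q)) z"
    unfolding bernstein_sum_def
    by (intro sum.cong refl) (simp only: node_value_power_elevate[OF m(1)] atMost_iff)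
  then have "genuine_alpha_BD n \<alpha> (\<lambda>z. z ^ Suc q) z =
    of_real \<alpha> * bernstein_sum (Suc m) (node_value (Suc m) (\<lambda>z. z ^ Suc q)) z + (1 - of_real \<alpha>) *
      bernstein_sum m (node_value m (\<lambda>z. z ^ Suc q)) z"
    unfolding m(2) genuine_alpha_BD_eq_sum[OF assms, unfolded m(2)] alpha_bernstein_sum[OF m(1)]
    by (simp only:)
  then show ?thesis unfolding bernstein_sum_node_value_power m(3) unfolding m(2) .
qed

text \<open>The exponent 0 lies outside \<open>genuine_alpha_BD_power\<close>; here both summands of
  \<open>alpha_bernstein_sum\<close> reduce to a partition of unity.\<close>

lemma genuine_alpha_BD_one:
  assumes "n \<ge> 1"
  shows "genuine_alpha_BD n \<alpha> (\<lambda>z. 1) z = 1"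
proof (cases "n = 1")
  case False
  define m where "m = n - 1"
  have m: "m \<ge> 1" "n = Suc m" using False assms by (auto simp: m_def)
  have "genuine_alpha_BD n \<alpha> (\<lambda>z. 1) z = (\<Sum>k\<le>n. alpha_bernstein n \<alpha> k z * 1)"
    unfolding genuine_alpha_BD_eq_sum[OF assms] by (intro sum.cong) (auto simp: node_value_one)
  also have "\<dots> = of_real \<alpha> * bernstein_sum n (\<lambda>k. 1) z + (1 - of_real \<alpha>) *
      bernstein_sum m (\<lambda>i. (of_nat (m - i) * 1 + of_nat i * 1) / of_nat m) z"
    unfolding m(2) by (rule alpha_bernstein_sum[OF m(1)])
  also have "bernstein_sum m (\<lambda>i. (of_nat (m - i) * 1 + of_nat i * 1) / of_nat m) z
      = bernstein_sum m (\<lambda>i. 1) z"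
    unfolding bernstein_sum_def using m(1) by (intro sum.cong) (auto simp: of_nat_diff)
  finally show ?thesis by (simp add: algebra_simps)
qed (simp add: genuine_alpha_BD_def alpha_bernstein_def)

section \<open>Moments of the weights and the error on monomials\<close>

lemma durrmeyer_weight_nonneg: "durrmeyer_weight n q j \<ge> 0"
  by (simp add: durrmeyer_weight_def)

lemma sum_durrmeyer_weight:
  assumes "n \<ge> 1"
  shows "(\<Sum>j\<le>Suc q. durrmeyer_weight n q j) = 1"
  using assms unfolding durrmeyer_weight_def
  by (simp only: flip: sum_divide_distrib of_nat_sum binomial_shift_convolution) simp

text \<open>The hypergeometric mean: \<open>j * (n choose j) = n * ((n - 1) choose (j - 1))\<close>
  pulls out \<open>n\<close>, and Vandermonde's identity applies again with
  \<open>n - 1\<close>.\<close>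

lemma sum_durrmeyer_weight_mult:
  assumes "n \<ge> 1"
  shows "(\<Sum>j\<le>Suc q. real j * durrmeyer_weight n q j) = real n * real (Suc q) / real (n + q)"
proof -
  have "(\<Sum>j\<le>Suc q. j * ((n choose j) * (q choose (Suc q - j))))
     = (\<Sum>j\<le>q. n * (((n - 1) choose j) * (q choose (q - j))))"
    unfolding sum.atMost_Suc_shift
    using times_binomial_minus1_eq[of "Suc _" n] by (simp del: binomial_Suc_Suc flip: mult.assoc)
  also have "\<dots> = n * ((n - 1 + q) choose q)"
    by (simp only: vandermonde flip: sum_distrib_left)
  finally have 1: "(\<Sum>j\<le>Suc q. j * ((n choose j) * (q choose (Suc q - j)))) = n * ((n - 1 + q) choose q)" .
  have "Suc q * ((n + q) choose Suc q) = (n + q) * ((n - 1 + q) choose q)"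
    using Suc_times_binomial[of q "n - 1 + q"] assms by simp
  then have 2: "real (Suc q) * real ((n + q) choose Suc q) = real (n + q) * real ((n - 1 + q) choose q)"
    by (metis of_nat_mult)
  have nz: "real ((n + q) choose Suc q) \<noteq> 0" "real (n + q) \<noteq> 0" using assms by auto
  have "(\<Sum>j\<le>Suc q. real j * durrmeyer_weight n q j)
      = real (\<Sum>j\<le>Suc q. j * ((n choose j) * (q choose (Suc q - j)))) / real ((n + q) choose Suc q)"
    unfolding durrmeyer_weight_def of_nat_sum sum_divide_distrib by simp
  also have "\<dots> = real n * real ((n - 1 + q) choose q) / real ((n + q) choose Suc q)"
    unfolding 1 by simp
  also have "\<dots> = real n * real (Suc q) / real (n + q)"
    using 2 nz by (simp add: divide_simps del: of_nat_Suc of_nat_add)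
  finally show ?thesis .
qed

text \<open>The weights sum to 1, so the error is a convex combination of the differences
  \<open>z ^ j - z ^ Suc q\<close>. A bound linear in \<open>j\<close> for these reduces the
  estimate to the mean.\<close>

lemma norm_durrmeyer_power_diff:
  fixes z :: complex
  assumes "n \<ge> 1" "r \<ge> 1" "norm z \<le> r"
  shows "norm ((\<Sum>j\<le>Suc q. of_real (durrmeyer_weight n q j) * z ^ j) - z ^ Suc q)
     \<le> 2 * real (Suc q) ^ 2 * r ^ Suc q / real n"
proof -
  let ?w = "durrmeyer_weight n q"
  have 1: "(\<Sum>j\<le>Suc q. complex_of_real (?w j)) = 1"
    by (simp only: sum_durrmeyer_weight[OF assms(1)] of_real_1 flip: of_real_sum)
  \<comment> \<open>The factor \<open>Suc q - j\<close> is at least 1 unless the difference is 0;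
    \<open>r \<ge> 1\<close> gives \<open>r ^ j \<le> r ^ Suc q\<close>.\<close>
  have diff: "norm (z ^ j - z ^ Suc q) \<le> 2 * r ^ Suc q * (real (Suc q) - real j)" if "j \<le> Suc q" for j
  proof (cases "j = Suc q")
    case False
    have "norm (z ^ j - z ^ Suc q) \<le> norm z ^ j + norm z ^ Suc q"
      using norm_triangle_ineq4[of "z ^ j" "z ^ Suc q"] by (simp only: norm_power)
    also have "\<dots> \<le> r ^ j + r ^ Suc q"
      using assms by (intro add_mono power_mono) auto
    also have "\<dots> \<le> r ^ Suc q + r ^ Suc q"
      using that assms by (intro add_mono power_increasing) auto
    also have "\<dots> = 2 * r ^ Suc q * 1" by simp
    also have "\<dots> \<le> 2 * r ^ Suc q * (real (Suc q) - real j)"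
      using that False assms by (intro mult_left_mono) auto
    finally show ?thesis .
  qed simp
  have "(\<Sum>j\<le>Suc q. of_real (?w j) * z ^ j) - z ^ Suc q
      = (\<Sum>j\<le>Suc q. of_real (?w j) * z ^ j) - (\<Sum>j\<le>Suc q. of_real (?w j)) * z ^ Suc q"
    unfolding 1 by simp
  also have "\<dots> = (\<Sum>j\<le>Suc q. of_real (?w j) * (z ^ j - z ^ Suc q))"
    by (simp only: sum_distrib_right sum_subtractf right_diff_distrib)
  also have "norm \<dots> \<le> (\<Sum>j\<le>Suc q. ?w j * (2 * r ^ Suc q * (real (Suc q) - real j)))"
    using diff durrmeyer_weight_nonneg[of n q]
    by (intro sum_norm_le) (auto simp: norm_mult simp del: power_Suc of_nat_Suc intro!: mult_left_mono)
  also have "\<dots> = 2 * r ^ Suc q * (real (Suc q) * (\<Sum>j\<le>Suc q. ?w j) - (\<Sum>j\<le>Suc q. real j * ?w j))"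
    by (simp only: sum_distrib_left right_diff_distrib sum_subtractf mult_ac)
  also have "\<dots> = 2 * r ^ Suc q * (real (Suc q) - real n * real (Suc q) / real (n + q))"
    unfolding sum_durrmeyer_weight[OF assms(1)] sum_durrmeyer_weight_mult[OF assms(1)] by simp
  \<comment> \<open>The distance of the mean from the top degree is the source of the rate
    \<open>1 / n\<close>.\<close>
  also have "real (Suc q) - real n * real (Suc q) / real (n + q) = real q * real (Suc q) / real (n + q)"
    using assms(1) by (simp add: field_simps)
  also have "\<dots> \<le> real (Suc q) ^ 2 / real n"
    using assms(1) by (intro frac_le) (auto simp: power2_eq_square intro!: mult_mono)
  finally show ?thesis
    using assms(2) by (simp add: mult_ac mult_left_mono del: power_Suc of_nat_Suc)
qed

text \<open>Convexity in \<alpha>. The constant grows from 2 to 4 because the second summand has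
  order \<open>max 1 (n - 1)\<close>, which is at least \<open>n / 2\<close>.\<close>

lemma norm_genuine_alpha_BD_power_diff:
  assumes "n \<ge> 1" "\<alpha> \<in> {0..1}" "r \<ge> 1" "norm z \<le> r"
  shows "norm (genuine_alpha_BD n \<alpha> (\<lambda>z. z ^ p) z - z ^ p) \<le> 4 * (real p ^ 2 * r ^ p) / real n"
proof (cases p)
  case 0
  then show ?thesis using assms by (simp add: genuine_alpha_BD_one)
next
  case (Suc q)
  let ?S = "\<lambda>m. (\<Sum>j\<le>Suc q. of_real (durrmeyer_weight m q j) * z ^ j) - z ^ Suc q"
  let ?m = "max 1 (n - 1)"
  have "genuine_alpha_BD n \<alpha> (\<lambda>z. z ^ p) z - z ^ p = of_real \<alpha> * ?S n + of_real (1 - \<alpha>) * ?S ?m"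
    unfolding Suc genuine_alpha_BD_power[OF assms(1)] by (simp add: algebra_simps del: power_Suc)
  also have "norm \<dots> \<le> \<alpha> * norm (?S n) + (1 - \<alpha>) * norm (?S ?m)"
    using assms(2) by (intro norm_triangle_le) (simp add: norm_mult del: power_Suc of_real_diff)
  also have "\<dots> \<le> \<alpha> * (4 * (real p ^ 2 * r ^ p) / real n) + (1 - \<alpha>) * (4 * (real p ^ 2 * r ^ p) / real n)"
  proof (intro add_mono mult_left_mono)
    have "norm (?S n) \<le> 2 * (real p ^ 2 * r ^ p) / real n"
      using norm_durrmeyer_power_diff[OF assms(1,3,4), of q] by (simp only: Suc mult.assoc)
    also have "\<dots> \<le> 4 * (real p ^ 2 * r ^ p) / real n"
      using assms by (intro divide_right_mono mult_right_mono) auto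
    finally show "norm (?S n) \<le> 4 * (real p ^ 2 * r ^ p) / real n" .
    have "norm (?S ?m) \<le> 2 * (real p ^ 2 * r ^ p) / real ?m"
      using norm_durrmeyer_power_diff[OF _ assms(3,4), of ?m q] by (simp only: Suc mult.assoc max.cobounded1)
    also have "\<dots> = (real p ^ 2 * r ^ p) * (2 / real ?m)" by simp
    also have "\<dots> \<le> (real p ^ 2 * r ^ p) * (4 / real n)"
      using assms by (intro mult_left_mono) (auto simp: divide_simps max_def)
    finally show "norm (?S ?m) \<le> 4 * (real p ^ 2 * r ^ p) / real n" by (simp add: mult_ac)
  qed (use assms in auto)
  finally show ?thesis unfolding distrib_right[symmetric] by simp
qed

section \<open>Linearity and positivity\<close>

lemma continuous_on_bernstein_basis [continuous_intros]:
  "continuous_on S (bernstein_basis n k)"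
  unfolding bernstein_basis_def[abs_def] by (intro continuous_intros)

lemma node_integrand_integrable:
  fixes f :: "complex \<Rightarrow> complex"
  assumes "continuous_on {0..1} (\<lambda>t::real. f (of_real t))"
  shows "(\<lambda>t. of_real (bernstein_basis n k t) * f (of_real t)) integrable_on {0..1::real}"
  using assms by (intro integrable_continuous_interval continuous_intros)

lemma node_value_lincomb:
  fixes f g :: "complex \<Rightarrow> complex"
  assumes "continuous_on {0..1} (\<lambda>t::real. f (of_real t))"
    and "continuous_on {0..1} (\<lambda>t::real. g (of_real t))"
  shows "node_value n (\<lambda>z. a * f z + b * g z) k = a * node_value n f k + b * node_value n g k"
proof -
  let ?B = "\<lambda>t. complex_of_real (bernstein_basis (n - 2) (k - 1) t)"
  have "integral {0..1::real} (\<lambda>t. ?B t * (a * f (of_real t) + b * g (of_real t)))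
     = integral {0..1::real} (\<lambda>t. a * (?B t * f (of_real t)) + b * (?B t * g (of_real t)))"
    by (simp add: algebra_simps)
  also have "\<dots> = a * integral {0..1::real} (\<lambda>t. ?B t * f (of_real t))
       + b * integral {0..1::real} (\<lambda>t. ?B t * g (of_real t))"
    using node_integrand_integrable[OF assms(1)] node_integrand_integrable[OF assms(2)]
    by (subst integral_add) (auto intro!: integrable_on_mult_right)
  finally show ?thesis
    by (simp add: node_value_def algebra_simps)
qed

lemma genuine_alpha_BD_lincomb:
  fixes f g :: "complex \<Rightarrow> complex"
  assumes "n \<ge> 1"
    and "continuous_on {0..1} (\<lambda>t::real. f (of_real t))"
    and "continuous_on {0..1} (\<lambda>t::real. g (of_real t))"
  shows "genuine_alpha_BD n \<alpha> (\<lambda>z. a * f z + b * g z) z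
       = a * genuine_alpha_BD n \<alpha> f z + b * genuine_alpha_BD n \<alpha> g z"
  by (simp add: genuine_alpha_BD_eq_sum[OF assms(1)] node_value_lincomb[OF assms(2,3)]
      algebra_simps sum.distrib sum_distrib_left)

lemma alpha_bernstein_of_real_nonneg:
  assumes "\<alpha> \<in> {0..1}" "x \<in> {0..1}"
  shows "\<exists>b\<ge>0. alpha_bernstein n \<alpha> k (of_real x) = of_real b"
proof (cases "n = 1")
  case True
  then have "alpha_bernstein n \<alpha> k (of_real x) = of_real (if k = 0 then 1 - x else if k = 1 then x else 0)"
    by (simp add: alpha_bernstein_def)
  then show ?thesis using assms(2) by (intro exI[of _ "if k = 0 then 1 - x else if k = 1 then x else 0"]) auto
next
  case False
  let ?b = "real ((n - 2) choose k) * (1 - \<alpha>) * x ^ k * (1 - x) ^ (n - k - 1)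
     + (if k < 2 then 0 else real ((n - 2) choose (k - 2)) * (1 - \<alpha>) * x ^ (k - 1) * (1 - x) ^ (n - k))
     + real (n choose k) * \<alpha> * x ^ k * (1 - x) ^ (n - k)"
  have "alpha_bernstein n \<alpha> k (of_real x) = of_real ?b"
    using False by (simp add: alpha_bernstein_def)
  moreover have "?b \<ge> 0" using assms by simp
  ultimately show ?thesis by blast
qed

lemma Re_node_value_nonneg:
  fixes f :: "complex \<Rightarrow> complex"
  assumes "continuous_on {0..1} (\<lambda>t::real. f (of_real t))"
    and "\<And>t::real. t \<in> {0..1} \<Longrightarrow> Re (f (of_real t)) \<ge> 0"
  shows "Re (node_value n f k) \<ge> 0"
proof -
  let ?g = "\<lambda>t. of_real (bernstein_basis (n - 2) (k - 1) t) * f (of_real t)"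
  have "((\<lambda>t. Re (?g t)) has_integral Re (integral {0..1::real} ?g)) {0..1}"
    using has_integral_linear[OF integrable_integral[OF node_integrand_integrable[OF assms(1)]] bounded_linear_Re]
    by (simp add: o_def)
  then have "Re (integral {0..1::real} ?g) \<ge> 0"
    by (rule has_integral_nonneg) (use assms(2) in \<open>auto simp: bernstein_basis_def\<close>)
  then show ?thesis
    using assms(2)[of 0] assms(2)[of 1] by (auto simp: node_value_def)
qed

text \<open>On \<open>{0..1}\<close> the factors \<open>alpha_bernstein\<close> are nonnegative
  reals, so taking real parts commutes with the sum and leaves nonnegative node values.\<close>

lemma Re_genuine_alpha_BD_nonneg:
  fixes f :: "complex \<Rightarrow> complex"
  assumes "n \<ge> 1" "\<alpha> \<in> {0..1}" "x \<in> {0..1}"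
    and "continuous_on {0..1} (\<lambda>t::real. f (of_real t))"
    and "\<And>t::real. t \<in> {0..1} \<Longrightarrow> Re (f (of_real t)) \<ge> 0"
  shows "Re (genuine_alpha_BD n \<alpha> f (of_real x)) \<ge> 0"
proof -
  have "Re (alpha_bernstein n \<alpha> k (of_real x) * node_value n f k) \<ge> 0" for k
    using alpha_bernstein_of_real_nonneg[OF assms(2,3), of n k] Re_node_value_nonneg[OF assms(4,5), of n k]
    by auto
  then show ?thesis
    by (simp only: genuine_alpha_BD_eq_sum[OF assms(1)] Re_sum sum_nonneg)
qed

section \<open>Quadratic polynomials and the lower bound\<close>

text \<open>Only the square is moved. \<kappa> is the convex combination of the weights
  \<open>2 / (m + 1)\<close> of \<open>z\<close> in the image of \<open>z ^ 2\<close> for the two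
  orders \<open>m\<close> involved, each at least \<open>1 / n\<close>.\<close>

lemma genuine_alpha_BD_quadratic:
  assumes "n \<ge> 1" "\<alpha> \<in> {0..1}"
  shows "\<exists>\<kappa>::real. \<kappa> \<ge> 1 / real n \<and>
    (\<forall>a b c z. genuine_alpha_BD n \<alpha> (\<lambda>z. a + b * z + c * z ^ 2) z
      = a + b * z + c * (z ^ 2 + of_real \<kappa> * z * (1 - z)))"
proof -
  let ?m = "max 1 (n - 1)"
  let ?k = "\<lambda>m. 2 / (real m + 1)"
  define \<kappa> where "\<kappa> = \<alpha> * ?k n + (1 - \<alpha>) * ?k ?m"
  have "?k n \<ge> 1 / real n" "?k ?m \<ge> 1 / real n"
    using assms(1) by (auto simp: divide_simps max_def)
  then have "\<kappa> \<ge> \<alpha> * (1 / real n) + (1 - \<alpha>) * (1 / real n)"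
    unfolding \<kappa>_def using assms(2) by (intro add_mono mult_left_mono) auto
  then have \<kappa>: "\<kappa> \<ge> 1 / real n" unfolding distrib_right[symmetric] by simp
  have w: "durrmeyer_weight m 1 0 = 0" "durrmeyer_weight m 1 1 = ?k m"
          "durrmeyer_weight m 1 2 = 1 - ?k m" if "m \<ge> 1" for m
  proof -
    have c2: "real (k choose 2) = real k * (real k - 1) / 2" for k
      by (simp add: binomial_gbinomial gbinomial_prod_rev numeral_2_eq_2 field_simps)
    show "durrmeyer_weight m 1 1 = ?k m" "durrmeyer_weight m 1 2 = 1 - ?k m"
      using that
      by (simp_all add: durrmeyer_weight_def numeral_2_eq_2[symmetric] c2)
         (simp_all add: field_simps)
  qed (simp add: durrmeyer_weight_def)
  have S2: "(\<Sum>j\<le>Suc 1. of_real (durrmeyer_weight m 1 j) * z ^ j) = z ^ 2 + of_real (?k m) * (z * (1 - z))"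
    if "m \<ge> 1" for m and z :: complex
  proof -
    have "(\<Sum>j\<le>Suc 1. of_real (durrmeyer_weight m 1 j) * z ^ j) = of_real (durrmeyer_weight m 1 0)
        + of_real (durrmeyer_weight m 1 1) * z + of_real (durrmeyer_weight m 1 2) * z ^ 2"
      by (simp add: numeral_2_eq_2)
    moreover have "of_real 0 + of_real u * z + of_real (1 - u) * z ^ 2 = z ^ 2 + of_real u * (z * (1 - z))"
      for u by (simp add: algebra_simps power2_eq_square)
    ultimately show ?thesis unfolding w[OF that] by (simp only:)
  qed
  have e2: "genuine_alpha_BD n \<alpha> (\<lambda>z. z ^ 2) z = z ^ 2 + of_real \<kappa> * z * (1 - z)" for z
  proof -
    have "genuine_alpha_BD n \<alpha> (\<lambda>z. z ^ Suc 1) z =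
      of_real \<alpha> * (z ^ 2 + of_real (?k n) * (z * (1 - z)))
      + (1 - of_real \<alpha>) * (z ^ 2 + of_real (?k ?m) * (z * (1 - z)))"
      unfolding genuine_alpha_BD_power[OF assms(1)]
      by (simp only: S2[OF assms(1)] S2[OF max.cobounded1])
    also have "\<dots> = z ^ 2 + of_real \<kappa> * z * (1 - z)"
      unfolding \<kappa>_def of_real_add of_real_mult of_real_diff by (simp add: algebra_simps)
    finally show ?thesis by (simp only: Suc_1)
  qed
  have e1: "genuine_alpha_BD n \<alpha> (\<lambda>z. z) z = z" for z
  proof -
    have S1: "(\<Sum>j\<le>Suc 0. of_real (durrmeyer_weight m 0 j) * z ^ j) = z" if "m \<ge> 1" for m
      using that by (simp add: durrmeyer_weight_def)
    have "genuine_alpha_BD n \<alpha> (\<lambda>z. z ^ Suc 0) z = z"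
      unfolding genuine_alpha_BD_power[OF assms(1)] S1[OF assms(1)] S1[OF max.cobounded1]
      by (simp add: algebra_simps)
    then show ?thesis by simp
  qed
  have "genuine_alpha_BD n \<alpha> (\<lambda>z. a + b * z + c * z ^ 2) z
      = a + b * z + c * (z ^ 2 + of_real \<kappa> * z * (1 - z))" for a b c z
  proof -
    have "genuine_alpha_BD n \<alpha> (\<lambda>z. a * 1 + b * z) z = a * 1 + b * z"
      by (subst genuine_alpha_BD_lincomb[OF assms(1)])
         (auto intro!: continuous_intros simp: e1 genuine_alpha_BD_one[OF assms(1)])
    then have l: "genuine_alpha_BD n \<alpha> (\<lambda>z. a + b * z) z = a + b * z" by simp
    have "genuine_alpha_BD n \<alpha> (\<lambda>z. 1 * (a + b * z) + c * z ^ 2) z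
       = 1 * (a + b * z) + c * (z ^ 2 + of_real \<kappa> * z * (1 - z))"
      by (subst genuine_alpha_BD_lincomb[OF assms(1)])
         (auto intro!: continuous_intros simp: l e2)
    then show ?thesis by simp
  qed
  with \<kappa> show ?thesis by blast
qed

text \<open>At a maximum of \<open>Re w\<close> on \<open>{0..1}\<close> a positive operator fixing the constants cannot
  increase \<open>Re w\<close>. Applied to \<open>w = a f - (linear part) - \<delta> z (1 - z)\<close>, whose maximum point does
  not depend on \<open>n\<close> and \<open>\<alpha>\<close>, this turns the known defect of \<open>z (1 - z)\<close> into one of \<open>f\<close>.\<close>

lemma genuine_alpha_BD_lower_bound:
  fixes f :: "complex \<Rightarrow> complex"
  assumes cont: "continuous_on {0..1} (\<lambda>t::real. f (of_real t))"
    and nonlin: "s \<in> {0..1}" "f (of_real s) \<noteq> f 0 + (f 1 - f 0) * of_real s"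
  shows "\<exists>C>0. \<exists>x\<in>{0..1::real}. \<forall>n\<ge>1. \<forall>\<alpha>\<in>{0..1}.
           C / real n \<le> norm (genuine_alpha_BD n \<alpha> f (of_real x) - f (of_real x))"
proof -
  \<comment> \<open>Multiplying by the conjugate of the deviation from the chord at \<open>s\<close>
    makes that deviation the positive real \<open>(norm a)\<^sup>2\<close>, so real parts can be
    compared.\<close>
  define a where "a = cnj (f (of_real s) - (f 0 + (f 1 - f 0) * of_real s))"
  have a0: "a \<noteq> 0" using nonlin(2) by (simp add: a_def del: complex_cnj_diff complex_cnj_add complex_cnj_mult)
  have s: "0 < s" "s < 1" using nonlin by (auto simp: less_le)
  \<comment> \<open>Since \<open>s * (1 - s) \<le> 1\<close>, half of
    \<open>(norm a)\<^sup>2\<close> keeps \<open>Re (w s)\<close> positive.\<close>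
  define \<delta> where "\<delta> = (norm a)\<^sup>2 / 2"
  have \<delta>: "\<delta> > 0" using a0 by (simp add: \<delta>_def)
  define w where "w = (\<lambda>z. a * f z
    + 1 * (- a * f 0 + (- a * (f 1 - f 0) - of_real \<delta>) * z + of_real \<delta> * z ^ 2))"
  have w_eq: "w z = a * (f z - (f 0 + (f 1 - f 0) * z)) - of_real \<delta> * (z * (1 - z))" for z
    by (simp add: w_def algebra_simps power2_eq_square)
  have contw: "continuous_on {0..1} (\<lambda>t::real. w (of_real t))"
    unfolding w_def by (intro continuous_intros cont)
  have "continuous_on {0..1} (\<lambda>t::real. Re (w (of_real t)))"
    by (intro continuous_intros contw)
  then obtain x where x: "x \<in> {0..1}" "\<And>t. t \<in> {0..1} \<Longrightarrow> Re (w (of_real t)) \<le> Re (w (of_real x))"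
    using continuous_attains_sup[of "{0..1::real}" "\<lambda>t. Re (w (of_real t))"] by auto
  have "Re (w (of_real s)) = (norm a)\<^sup>2 - \<delta> * (s * (1 - s))"
  proof -
    have "w (of_real s) = a * cnj a - of_real \<delta> * (of_real s * (1 - of_real s))"
      unfolding w_eq by (simp add: a_def)
    also have "\<dots> = of_real ((norm a)\<^sup>2 - \<delta> * (s * (1 - s)))"
      by (simp flip: complex_norm_square)
    finally show ?thesis by simp
  qed
  also have "\<dots> \<ge> (norm a)\<^sup>2 - \<delta> * 1"
    using s \<delta> by (intro diff_left_mono mult_left_mono mult_le_one) auto
  finally have "Re (w (of_real s)) > 0" using \<delta> unfolding \<delta>_def by linarith
  then have "Re (w (of_real x)) > 0" using x(2)[OF nonlin(1)] by linarith
  \<comment> \<open>\<open>w\<close> vanishes at both endpoints, so a point with a positive value is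
    interior.\<close>
  then have "x \<noteq> 0" "x \<noteq> 1" by (auto simp: w_eq)
  then have x01: "0 < x" "x < 1" using x(1) by auto
  define C where "C = \<delta> * (x * (1 - x)) / norm a"
  have "C > 0" using x01 \<delta> a0 by (simp add: C_def)
  moreover have "C / real n \<le> norm (genuine_alpha_BD n \<alpha> f (of_real x) - f (of_real x))"
    if n: "n \<ge> 1" and \<alpha>: "\<alpha> \<in> {0..1}" for n \<alpha>
  proof -
    let ?G = "genuine_alpha_BD n \<alpha>" and ?x = "complex_of_real x"
    obtain \<kappa> where \<kappa>: "\<kappa> \<ge> 1 / real n"
       "\<And>a b c z. ?G (\<lambda>z. a + b * z + c * z ^ 2) z = a + b * z + c * (z ^ 2 + of_real \<kappa> * z * (1 - z))"
      using genuine_alpha_BD_quadratic[OF n \<alpha>] by blast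
    \<comment> \<open>The affine part is reproduced; the term \<open>\<delta> z ^ 2\<close>
      contributes the shift with \<kappa>.\<close>
    have Gw: "?G w ?x = w ?x + a * (?G f ?x - f ?x) + of_real \<delta> * of_real \<kappa> * ?x * (1 - ?x)"
    proof -
      have "?G w ?x = a * ?G f ?x
          + 1 * ?G (\<lambda>z. - a * f 0 + (- a * (f 1 - f 0) - of_real \<delta>) * z + of_real \<delta> * z ^ 2) ?x"
        unfolding w_def by (rule genuine_alpha_BD_lincomb[OF n cont]) (intro continuous_intros)
      then show ?thesis unfolding \<kappa>(2) by (simp add: w_def algebra_simps power2_eq_square)
    qed
    have "?G (\<lambda>z. 1 * w ?x + (-1) * w z) ?x = 1 * w ?x + (-1) * ?G w ?x"
    proof -
      have "?G (\<lambda>z. w ?x * 1 + (-1) * w z) ?x = w ?x * ?G (\<lambda>z. 1) ?x + (-1) * ?G w ?x"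
        by (rule genuine_alpha_BD_lincomb[OF n _ contw]) auto
      then show ?thesis by (simp add: genuine_alpha_BD_one[OF n])
    qed
    \<comment> \<open>Positivity applies because \<open>w x - w\<close> has nonnegative real part on
      \<open>{0..1}\<close> by the choice of \<open>x\<close>.\<close>
    moreover have "Re (?G (\<lambda>z. 1 * w ?x + (-1) * w z) ?x) \<ge> 0"
      using x contw by (intro Re_genuine_alpha_BD_nonneg[OF n \<alpha>] continuous_intros) auto
    ultimately have "Re (a * (?G f ?x - f ?x) + of_real \<delta> * of_real \<kappa> * ?x * (1 - ?x)) \<le> 0"
      by (simp add: Gw)
    moreover have "of_real \<delta> * of_real \<kappa> * ?x * (1 - ?x) = of_real (\<delta> * \<kappa> * (x * (1 - x)))"
      by simp
    ultimately have "\<delta> * \<kappa> * (x * (1 - x)) \<le> - Re (a * (?G f ?x - f ?x))"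
      by (simp only: plus_complex.sel Re_complex_of_real)
    also have "\<dots> \<le> norm a * norm (?G f ?x - f ?x)"
      using abs_Re_le_cmod[of "a * (?G f ?x - f ?x)"] unfolding norm_mult by linarith
    finally have "\<delta> * \<kappa> * (x * (1 - x)) \<le> norm a * norm (?G f ?x - f ?x)" .
    moreover have "\<delta> * (1 / real n) * (x * (1 - x)) \<le> \<delta> * \<kappa> * (x * (1 - x))"
      using \<kappa>(1) \<delta> x01 by (intro mult_right_mono mult_left_mono) auto
    ultimately have "\<delta> * (1 / real n) * (x * (1 - x)) \<le> norm a * norm (?G f ?x - f ?x)" by linarith
    then show ?thesis using a0 n by (simp add: C_def field_simps)
  qed
  ultimately show ?thesis using x(1) by blast
qed

section \<open>Power series and the upper bound\<close>

text \<open>Absolutely summable coefficients make the series uniformly convergent on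
  \<open>{0..1}\<close>, so it may be integrated term by term; endpoint nodes use convergence at 0
  and 1.\<close>

lemma node_value_sums:
  fixes f :: "complex \<Rightarrow> complex" and c :: "nat \<Rightarrow> complex"
  assumes sums: "\<And>z. norm z \<le> 1 \<Longrightarrow> (\<lambda>p. c p * z ^ p) sums f z"
    and abs: "summable (\<lambda>p. norm (c p))"
  shows "(\<lambda>p. c p * node_value n (\<lambda>z. z ^ p) k) sums node_value n f k"
proof -
  let ?B = "\<lambda>t. complex_of_real (bernstein_basis (n - 2) (k - 1) t)"
  let ?F = "\<lambda>N t. \<Sum>p<N. c p * (?B t * of_real t ^ p)"
  have "(\<lambda>p. c p * integral {0..1::real} (\<lambda>t. ?B t * of_real t ^ p))
          sums integral {0..1::real} (\<lambda>t. ?B t * f (of_real t))"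
  proof -
    have "uniform_limit {0..1} (\<lambda>N t. \<Sum>p<N. c p * complex_of_real t ^ p)
        (\<lambda>t. \<Sum>p. c p * of_real t ^ p) sequentially"
      by (rule Weierstrass_m_test[OF _ abs]) (auto simp: norm_mult norm_power intro!: mult_left_le power_le_one)
    also have "?this \<longleftrightarrow> uniform_limit {0..1} (\<lambda>N t. \<Sum>p<N. c p * complex_of_real t ^ p)
        (\<lambda>t. f (of_real t)) sequentially"
      using sums by (intro uniform_limit_cong') (auto simp: sums_iff)
    finally have lim: "uniform_limit {0..1} (\<lambda>N t. \<Sum>p<N. c p * complex_of_real t ^ p)
        (\<lambda>t. f (of_real t)) sequentially" .
    \<comment> \<open>Continuity comes from the uniform limit and yields the boundedness needed to
      multiply by the basis polynomial.\<close>
    have contf: "continuous_on {0..1} (\<lambda>t::real. f (of_real t))"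
      by (rule uniform_limit_theorem[OF _ lim]) (auto intro!: always_eventually continuous_intros)
    have "uniform_limit {0..1} (\<lambda>N t. ?B t * (\<Sum>p<N. c p * complex_of_real t ^ p))
        (\<lambda>t. ?B t * f (of_real t)) sequentially"
      by (intro uniform_lim_mult lim uniform_limit_const compact_imp_bounded
          compact_continuous_image contf continuous_intros) auto
    then have lim': "uniform_limit {0..1} ?F (\<lambda>t. ?B t * f (of_real t)) sequentially"
      by (simp only: sum_distrib_left mult.left_commute)
    obtain I J where I: "\<And>N. (?F N has_integral I N) {0..1}"
      and J: "((\<lambda>t. ?B t * f (of_real t)) has_integral J) {0..1}" and IJ: "I \<longlonglongrightarrow> J"
      by (rule uniform_limit_integral[OF lim']) (auto intro!: continuous_intros)
    have I_eq: "I N = (\<Sum>p<N. c p * integral {0..1::real} (\<lambda>t. ?B t * of_real t ^ p))" for N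
    proof -
      have "(?F N has_integral (\<Sum>p<N. c p * integral {0..1::real} (\<lambda>t. ?B t * of_real t ^ p))) {0..1}"
        by (intro has_integral_sum has_integral_mult_right integrable_integral node_integrand_integrable[of "\<lambda>z. z ^ _"])
           (auto intro!: continuous_intros)
      with I show ?thesis by (rule has_integral_unique)
    qed
    show ?thesis using IJ unfolding sums_def integral_unique[OF J] I_eq .
  qed
  from sums_mult[OF this, of "of_nat (n - 1)"] sums[of 0] sums[of 1]
  show ?thesis by (auto simp: node_value_def mult_ac)
qed

text \<open>\<open>f\<close> enters only through node values on \<open>{0..1}\<close>, so
  convergence on the closed unit disc gives the expansion at every \<open>z\<close>.\<close>

lemma genuine_alpha_BD_sums:
  fixes f :: "complex \<Rightarrow> complex" and c :: "nat \<Rightarrow> complex"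
  assumes "n \<ge> 1" "\<And>z. norm z \<le> 1 \<Longrightarrow> (\<lambda>p. c p * z ^ p) sums f z" "summable (\<lambda>p. norm (c p))"
  shows "(\<lambda>p. c p * genuine_alpha_BD n \<alpha> (\<lambda>z. z ^ p) z) sums genuine_alpha_BD n \<alpha> f z"
proof -
  have "(\<lambda>p. \<Sum>k\<le>n. alpha_bernstein n \<alpha> k z * (c p * node_value n (\<lambda>z. z ^ p) k))
     sums (\<Sum>k\<le>n. alpha_bernstein n \<alpha> k z * node_value n f k)"
    by (intro sums_sum sums_mult node_value_sums assms)
  then show ?thesis
    by (simp add: genuine_alpha_BD_eq_sum[OF assms(1)] sum_distrib_left mult_ac)
qed

text \<open>For \<open>r < s < u\<close> the factor \<open>p ^ 2\<close> is absorbed by enlarging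
  \<open>r\<close> to \<open>s\<close>, and the series converges absolutely at
  \<open>s\<close>.\<close>

lemma summable_square_power_series:
  fixes c :: "nat \<Rightarrow> complex"
  assumes "summable (\<lambda>p. c p * of_real u ^ p)" "0 < r" "r < u"
  shows "summable (\<lambda>p. norm (c p) * (real p ^ 2 * r ^ p))"
proof -
  define s where "s = (r + u) / 2"
  have s: "r < s" "s < u" using assms by (auto simp: s_def)
  \<comment> \<open>The square root splits \<open>(r / s) ^ p\<close> into two factors
    \<open>\<rho> ^ p\<close>, one for each factor \<open>p\<close>.\<close>
  define \<rho> where "\<rho> = sqrt (r / s)"
  have \<rho>: "0 < \<rho>" "\<rho> < 1" "\<rho> ^ 2 = r / s" using assms s by (auto simp: \<rho>_def)
  have "(\<lambda>p. of_nat p * \<rho> ^ p) \<longlonglongrightarrow> 0" using \<rho> by (intro powser_times_n_limit_0) auto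
  then have "Bseq (\<lambda>p. of_nat p * \<rho> ^ p)" by (intro convergent_imp_Bseq convergentI)
  then obtain M where M: "\<And>p. norm (of_nat p * \<rho> ^ p) \<le> M" by (auto simp: Bseq_def)
  have "summable (\<lambda>p. norm (c p * of_real s ^ p))"
    using powser_insidea[OF assms(1), of "of_real s"] s assms by simp
  then have "summable (\<lambda>p. M\<^sup>2 * norm (c p * of_real s ^ p))" by (rule summable_mult)
  then show ?thesis
  proof (rule summable_comparison_test'[where N = 0])
    fix p :: nat
    have "real p ^ 2 * r ^ p = (real p * \<rho> ^ p)\<^sup>2 * s ^ p"
    proof -
      have "(\<rho> ^ p)\<^sup>2 = (r / s) ^ p" by (metis \<rho>(3) power_mult mult.commute)
      then show ?thesis using assms s by (simp add: power_mult_distrib power_divide)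
    qed
    also have "\<dots> \<le> M\<^sup>2 * s ^ p"
      using M[of p] assms s \<rho> by (intro mult_right_mono power_mono) auto
    finally show "norm (norm (c p) * (real p ^ 2 * r ^ p)) \<le> M\<^sup>2 * norm (c p * of_real s ^ p)"
      using assms s by (auto simp: norm_mult norm_power mult_left_mono mult.left_commute)
  qed
qed

lemma norm_genuine_alpha_BD_diff:
  fixes f :: "complex \<Rightarrow> complex" and c :: "nat \<Rightarrow> complex"
  assumes n: "n \<ge> 1" and \<alpha>: "\<alpha> \<in> {0..1}" and r: "r \<ge> 1" "norm z \<le> r"
    and sums: "\<And>z. norm z \<le> r \<Longrightarrow> (\<lambda>p. c p * z ^ p) sums f z"
    and abs: "summable (\<lambda>p. norm (c p))"
    and sq: "summable (\<lambda>p. norm (c p) * (real p ^ 2 * r ^ p))"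
  shows "norm (genuine_alpha_BD n \<alpha> f z - f z) \<le> 4 * (\<Sum>p. norm (c p) * (real p ^ 2 * r ^ p)) / real n"
proof -
  let ?d = "\<lambda>p. c p * (genuine_alpha_BD n \<alpha> (\<lambda>z. z ^ p) z - z ^ p)"
  let ?e = "\<lambda>p. 4 / real n * (norm (c p) * (real p ^ 2 * r ^ p))"
  have "?d sums (genuine_alpha_BD n \<alpha> f z - f z)"
    unfolding right_diff_distrib
    using r by (intro sums_diff genuine_alpha_BD_sums n sums abs) auto
  then have "genuine_alpha_BD n \<alpha> f z - f z = suminf ?d" by (simp add: sums_iff)
  also have "norm \<dots> \<le> suminf ?e"
  proof (rule norm_suminf_le)
    fix p
    show "norm (?d p) \<le> ?e p"
      using mult_left_mono[OF norm_genuine_alpha_BD_power_diff[OF n \<alpha> r, of p], of "norm (c p)"]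
      by (simp add: norm_mult mult_ac)
  qed (rule summable_mult[OF sq])
  also have "\<dots> = 4 / real n * (\<Sum>p. norm (c p) * (real p ^ 2 * r ^ p))"
    by (rule suminf_mult[OF sq])
  finally show ?thesis by simp
qed

section \<open>The identity theorem and the two-sided estimate\<close>

text \<open>The identity theorem, as \<open>{0..1}\<close> accumulates at 0. It lets a function that
  is not affine on the disc be detected on \<open>{0..1}\<close>.\<close>

lemma holomorphic_linear_on_unit_interval:
  assumes "R > 1" "f holomorphic_on ball 0 R" "\<And>t::real. t \<in> {0..1} \<Longrightarrow> f (of_real t) = a + b * of_real t"
    and "z \<in> ball 0 R"
  shows "f z = a + b * z"
proof -
  have "f z - (a + b * z) = 0"
  proof (rule analytic_continuation[where f = "\<lambda>z. f z - (a + b * z)" and w = z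
        and S = "ball 0 R" and U = "of_real ` {0..1::real}" and \<xi> = 0])
    show "0 islimpt complex_of_real ` {0..1}"
      unfolding islimpt_approachable
    proof (intro allI impI)
      fix e :: real assume "e > 0"
      then show "\<exists>x'\<in>complex_of_real ` {0..1}. x' \<noteq> 0 \<and> dist x' 0 < e"
        by (intro bexI[of _ "of_real (min 1 (e / 2))"]) auto
    qed
  qed (use assms in \<open>auto intro!: holomorphic_intros\<close>)
  then show ?thesis by simp
qed

theorem theorem3:
  fixes R r :: real and f :: "complex \<Rightarrow> complex" and c :: "nat \<Rightarrow> complex"
  assumes "R > 1"
    and "f analytic_on ball 0 R"
    and "\<And>z. z \<in> ball 0 R \<Longrightarrow> (\<lambda>p. c p * z ^ p) sums f z"
    and "\<not> (\<exists>q :: complex poly. degree q \<le> 1 \<and> (\<forall>z\<in>ball 0 R. f z = poly q z))"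
    and "1 \<le> r" and "r < R"
  shows "\<exists>C1 C2 :: real. 0 < C1 \<and> C1 \<le> C2 \<and>
           (\<forall>\<alpha>\<in>{0..1}. \<forall>n::nat. n \<ge> 1 \<longrightarrow>
              C1 / real n \<le> disc_norm r (\<lambda>z. genuine_alpha_BD n \<alpha> f z - f z) \<and>
              disc_norm r (\<lambda>z. genuine_alpha_BD n \<alpha> f z - f z) \<le> C2 / real n)"
proof -
  have hol: "f holomorphic_on ball 0 R" using assms(2) by (rule analytic_imp_holomorphic)
  \<comment> \<open>A radius strictly between \<open>r\<close> and \<open>R\<close> leaves room for
    the factor \<open>p ^ 2\<close> in the majorant.\<close>
  define u where "u = (r + R) / 2"
  have u: "r < u" "u < R" using assms(6) by (auto simp: u_def)
  have su: "summable (\<lambda>p. c p * of_real u ^ p)"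
    using assms(3)[of "of_real u"] u assms(5) by (auto simp: sums_iff)
  have abs: "summable (\<lambda>p. norm (c p))"
    using powser_insidea[OF su, of 1] u assms(5) by simp
  have sq: "summable (\<lambda>p. norm (c p) * (real p ^ 2 * r ^ p))"
    using su u assms(5) by (intro summable_square_power_series[of c u r]) auto
  define C2 where "C2 = 4 * (\<Sum>p. norm (c p) * (real p ^ 2 * r ^ p))"
  have upper: "norm (genuine_alpha_BD n \<alpha> f z - f z) \<le> C2 / real n"
    if "n \<ge> 1" "\<alpha> \<in> {0..1}" "norm z \<le> r" for n \<alpha> z
    unfolding C2_def
    by (rule norm_genuine_alpha_BD_diff[OF that(1,2) assms(5) that(3) assms(3) abs sq]) (use assms(6) in auto)

  have "\<exists>s\<in>{0..1::real}. f (of_real s) \<noteq> f 0 + (f 1 - f 0) * of_real s"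
  proof (rule ccontr)
    assume "\<not> ?thesis"
    then have "f z = poly [:f 0, f 1 - f 0:] z" if "z \<in> ball 0 R" for z
      using holomorphic_linear_on_unit_interval[OF assms(1) hol _ that, of "f 0" "f 1 - f 0"] by (simp add: mult.commute)
    moreover have "degree [:f 0, f 1 - f 0:] \<le> 1" by simp
    ultimately show False using assms(4) by blast
  qed
  then obtain s where s: "s \<in> {0..1::real}" "f (of_real s) \<noteq> f 0 + (f 1 - f 0) * of_real s" by blast
  have "continuous_on {0..1} (\<lambda>t::real. f (of_real t))"
    by (rule continuous_on_compose2[OF holomorphic_on_imp_continuous_on[OF hol]])
       (use assms(1) in \<open>auto intro!: continuous_intros\<close>)
  from genuine_alpha_BD_lower_bound[OF this s] obtain C1 x where C1: "C1 > 0" and x: "x \<in> {0..1::real}"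
    and lower: "\<And>n \<alpha>. n \<ge> 1 \<Longrightarrow> \<alpha> \<in> {0..1} \<Longrightarrow>
        C1 / real n \<le> norm (genuine_alpha_BD n \<alpha> f (of_real x) - f (of_real x))"
    by blast
  have xr: "complex_of_real x \<in> cball 0 r" using x assms(5) by auto
  \<comment> \<open>Both bounds hold for the same value at \<open>x\<close> when
    \<open>n = 1\<close> and \<open>\<alpha> = 0\<close>.\<close>
  have "C1 \<le> C2" using lower[of 1 0] upper[of 1 0 "of_real x"] xr by simp
  moreover have "C1 / real n \<le> disc_norm r (\<lambda>z. genuine_alpha_BD n \<alpha> f z - f z)"
    if "n \<ge> 1" "\<alpha> \<in> {0..1}" for n \<alpha>
  proof -
    \<comment> \<open>The pointwise upper bound ensures that the supremum in
      \<open>disc_norm\<close> dominates the value at \<open>x\<close>.\<close>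
    have "bdd_above ((\<lambda>z. norm (genuine_alpha_BD n \<alpha> f z - f z)) ` cball 0 r)"
      by (rule bdd_aboveI2[where M = "C2 / real n"]) (use upper[OF that] in simp)
    from cSUP_upper[OF xr this] lower[OF that] show ?thesis
      unfolding disc_norm_def by linarith
  qed
  moreover have "disc_norm r (\<lambda>z. genuine_alpha_BD n \<alpha> f z - f z) \<le> C2 / real n"
    if "n \<ge> 1" "\<alpha> \<in> {0..1}" for n \<alpha>
    unfolding disc_norm_def by (rule cSUP_least) (use xr upper[OF that] in auto)
  ultimately show ?thesis using C1 by blast
qed

end
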